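(* (Landsberg–Schaar relation.) For all positive integers $a$ and $b$, $$\frac{1}{\sqrt{a}}\sum_{n=0}^{a-1}\exp\left(\frac{2\pi i n^2 b}{a}\right)=\frac{1}{\sqrt{2b}}\exp\left(\frac{\pi i}{4}\right)\sum_{n=0}^{2b-1}\exp\left(-\frac{\pi i n^2 a}{2b}\right).$$
   Context: Here $i$ is the imaginary unit and the square roots are the positive real square roots. *)

theory Defs
  imports Complex_Main
begin

end

(* With h(z) = sum_{n<a} exp(2 pi i b (z + n)^2 / a), the left-hand Gauss sum is h(0), which
   is the contour integral of g(z) = h(z) / (exp(2 pi i z) - 1) around a parallelogram with
   vertices 1/2 +- R e and -1/2 +- R e, where e = exp(pi i / 4).  The difference h(z + 1) - h(z)
   telescopes and is divisible by exp(2 pi i z) - 1, so the two long sides together contribute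
   the integral of sum_{k<2b} exp(2 pi i b z^2 / a + 2 pi i k z).  In the direction e these are
   decaying Gaussians; completing the square yields the right-hand side as R tends to infinity,
   while the short sides contribute nothing in the limit. *)

theory Submission
  imports Defs "HOL-Complex_Analysis.Complex_Analysis" "HOL-Probability.Characteristic_Functions"
    "HOL-Real_Asymp.Real_Asymp"
begin

section \<open>Gaussian integrals with a complex shift\<close>

lemma has_bochner_integral_gaussian_complex:
  fixes \<alpha> :: real and c :: complex
  assumes "\<alpha> > 0"
  shows "has_bochner_integral lborel (\<lambda>t::real. exp (- of_real \<alpha> * (of_real t + c)\<^sup>2)) (of_real (sqrt (pi / \<alpha>)))"
proof -
  \<comment> \<open>\<open>m\<close> is chosen so that \<alpha> t^2 = (m t)^2 / 2, the exponent of
    the standard normal density.\<close>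
  define u v m where "u = Re c" and "v = Im c" and "m = sqrt (2 * \<alpha>)"
  have c: "c = of_real u + \<i> * of_real v"
    by (simp add: u_def v_def complex_eq)
  have m: "m > 0" "m\<^sup>2 = 2 * \<alpha>"
    using assms by (auto simp: m_def)
  \<comment> \<open>With this frequency, \<i> s m (u + t) is the cross term -2 \<i> \<alpha> v (u +
    t) of the exponent.\<close>
  define s where "s = - m * v"
  \<comment> \<open>The real part of \<open>c\<close> is a translation; the imaginary part is the argument of the
    characteristic function of the normal distribution.\<close>
  have char: "(CLINT x|lborel. std_normal_density x *\<^sub>R iexp (s * x)) = of_real (exp (- (s\<^sup>2) / 2))"
    using fun_cong[OF char_std_normal_distribution, of s]
    unfolding char_def by (subst (asm) integral_density) auto
  have int: "integrable lborel (\<lambda>x. std_normal_density x *\<^sub>R iexp (s * x))"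
    by (rule Bochner_Integration.integrable_bound[OF integrable_normal_density[of 1 0]]) auto
  have "has_bochner_integral lborel (\<lambda>x. std_normal_density x *\<^sub>R iexp (s * x))
          (of_real (exp (- (s\<^sup>2) / 2)))"
    using int char by (simp add: has_bochner_integral_iff)
  then have "has_bochner_integral lborel
      (\<lambda>t. std_normal_density (m * u + m * t) *\<^sub>R iexp (s * (m * u + m * t)))
      (of_real (exp (- (s\<^sup>2) / 2)) /\<^sub>R \<bar>m\<bar>)"
    using m by (subst (asm) lborel_has_bochner_integral_real_affine_iff[of m _ _ "m * u"]) auto
  \<comment> \<open>The factor removes the normalisation of the density and restores the term
    \<alpha> v^2 of the exponent; in the value of the integral it cancels exp (- s^2 / 2).\<close>
  then have "has_bochner_integral lborel
      (\<lambda>t. of_real (exp (\<alpha> * v\<^sup>2) * sqrt (2 * pi)) *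
           (std_normal_density (m * u + m * t) *\<^sub>R iexp (s * (m * u + m * t))))
      (of_real (exp (\<alpha> * v\<^sup>2) * sqrt (2 * pi)) * (of_real (exp (- (s\<^sup>2) / 2)) /\<^sub>R \<bar>m\<bar>))"
    by (rule has_bochner_integral_mult_right)
  moreover have "of_real (exp (\<alpha> * v\<^sup>2) * sqrt (2 * pi)) *
           (std_normal_density (m * u + m * t) *\<^sub>R iexp (s * (m * u + m * t)))
        = exp (- of_real \<alpha> * (of_real t + c)\<^sup>2)" for t
  proof -
    have "of_real (exp (\<alpha> * v\<^sup>2) * sqrt (2 * pi)) *
           (std_normal_density (m * u + m * t) *\<^sub>R iexp (s * (m * u + m * t)))
        = exp (of_real (\<alpha> * v\<^sup>2 - (m * u + m * t)\<^sup>2 / 2) + \<i> * of_real (s * (m * u + m * t)))"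
    proof -
      have "sqrt (2 * pi) * std_normal_density (m * u + m * t) = exp (- ((m * u + m * t)\<^sup>2) / 2)"
        by (simp add: std_normal_density_def)
      then have "exp (\<alpha> * v\<^sup>2 - (m * u + m * t)\<^sup>2 / 2)
          = exp (\<alpha> * v\<^sup>2) * (sqrt (2 * pi) * std_normal_density (m * u + m * t))"
        by (simp only: exp_add[symmetric]) simp
      then show ?thesis
        by (simp only: exp_add exp_of_real of_real_mult scaleR_conv_of_real mult.assoc)
    qed
    also have "of_real (\<alpha> * v\<^sup>2 - (m * u + m * t)\<^sup>2 / 2) + \<i> * of_real (s * (m * u + m * t))
        = of_real (\<alpha> * v\<^sup>2 - m\<^sup>2 * (u + t)\<^sup>2 / 2) - \<i> * of_real (m\<^sup>2 * v * (u + t))"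
      by (simp add: s_def power2_eq_square algebra_simps)
    also have "\<dots> = - of_real \<alpha> * (of_real t + c)\<^sup>2"
      unfolding m c by (simp add: complex_eq_iff power2_eq_square algebra_simps)
    finally show ?thesis .
  qed
  moreover have "of_real (exp (\<alpha> * v\<^sup>2) * sqrt (2 * pi)) * (of_real (exp (- (s\<^sup>2) / 2)) /\<^sub>R \<bar>m\<bar>)
      = (of_real (sqrt (pi / \<alpha>)) :: complex)"
  proof -
    have "exp (\<alpha> * v\<^sup>2) * exp (- (s\<^sup>2) / 2) = 1"
      by (simp add: s_def power_mult_distrib m flip: exp_add)
    moreover have "sqrt (2 * pi) / m = sqrt (pi / \<alpha>)"
      using assms by (simp add: m_def real_sqrt_mult real_sqrt_divide field_simps)
    ultimately have "exp (\<alpha> * v\<^sup>2) * sqrt (2 * pi) * (exp (- (s\<^sup>2) / 2) / m) = sqrt (pi / \<alpha>)"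
      using mult.assoc[of "exp (\<alpha> * v\<^sup>2)" "exp (- (s\<^sup>2) / 2)" "sqrt (2 * pi) / m"] by (simp add: mult_ac)
    then show ?thesis
      using m by (simp add: scaleR_conv_of_real field_simps flip: of_real_mult of_real_divide)
  qed
  ultimately show ?thesis by simp
qed

section \<open>Gaussian integrals along lines in the direction of a square root of \<i>\<close>

lemma has_contour_integral_linepath_translate:
  "(f has_contour_integral I) (linepath (p + c) (q + c)) \<longleftrightarrow>
   ((\<lambda>z. f (z + c)) has_contour_integral I) (linepath p q)"
proof -
  have "linepath (p + c) (q + c) x = linepath p q x + c" for x
    by (simp add: linepath_def algebra_simps)
  then show ?thesis
    by (simp add: has_contour_integral_linepath)
qed

text \<open>Substituting t = 2 R x - R carries [0, 1] to [-R, R]; the factor 2 R cancels against the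
  speed 2 R e of the path and leaves e.\<close>

lemma has_contour_integral_linepath_centred:
  assumes "R > 0" and "((\<lambda>t. f (p + of_real t * e)) has_integral I) {-R..R}"
  shows "(f has_contour_integral (e * I)) (linepath (p - of_real R * e) (p + of_real R * e))"
proof -
  have "((\<lambda>x. f (p + of_real (2 * R * x + - R) * e)) has_integral I /\<^sub>R (2 * R)) {0..1}"
    using has_integral_affinity'[of "\<lambda>t. f (p + of_real t * e)" I "-R" R "2 * R" "- R"] assms
    by (auto simp: field_simps)
  then have "((\<lambda>x. f (p + of_real (2 * R * x + - R) * e) * (of_real (2 * R) * e))
      has_integral I /\<^sub>R (2 * R) * (of_real (2 * R) * e)) {0..1}"
    by (rule has_integral_mult_left)
  moreover have "I /\<^sub>R (2 * R) * (of_real (2 * R) * e) = e * I"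
    using assms by (simp add: scaleR_conv_of_real field_simps)
  moreover have "linepath (p - of_real R * e) (p + of_real R * e) x = p + of_real (2 * R * x + - R) * e" for x
    by (simp add: linepath_def scaleR_conv_of_real algebra_simps)
  moreover have "p + of_real R * e - (p - of_real R * e) = of_real (2 * R) * e"
    by (simp add: algebra_simps)
  ultimately show ?thesis
    unfolding has_contour_integral_linepath by (simp only:)
qed

text \<open>Dominated convergence with majorant |f|; the truncated Lebesgue integrals agree with the
  gauge integrals that contour integration uses.\<close>

lemma tendsto_integral_symmetric_interval:
  fixes f :: "real \<Rightarrow> 'a :: euclidean_space"
  assumes "has_bochner_integral lborel f I"
  shows "((\<lambda>R. integral {-R..R} f) \<longlongrightarrow> I) at_top"
proof -
  have int: "integrable lborel f" and I: "I = integral\<^sup>L lborel f"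
    using assms by (auto simp: has_bochner_integral_iff)
  have set_int: "set_integrable lborel A f" if "A \<in> sets borel" for A
    using int that by (simp add: set_integrable_def integrable_mult_indicator)
  have "((\<lambda>R. \<integral>x. indicator {-R..R} x *\<^sub>R f x \<partial>lborel) \<longlongrightarrow> integral\<^sup>L lborel f) at_top"
  proof (rule integral_dominated_convergence_at_top[where w = "\<lambda>x. norm (f x)"])
    show "AE x in lborel. ((\<lambda>R. indicator {-R..R} x *\<^sub>R f x) \<longlongrightarrow> f x) at_top"
    proof (intro AE_I2 tendsto_eventually)
      fix x
      show "\<forall>\<^sub>F R in at_top. indicator {-R..R} x *\<^sub>R f x = f x"
        using eventually_ge_at_top[of "\<bar>x\<bar>"] by eventually_elim (auto simp: indicator_def)
    qed
  qed (use int in \<open>auto simp: indicator_def\<close>)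
  then show ?thesis
    using set_borel_integral_eq_integral(2)[OF set_int]
    by (simp add: I set_lebesgue_integral_def)
qed

text \<open>Completing the square and using e^2 = \<i> turns the integrand on the line into a
  constant times a real-variable Gaussian with complex shift \<open>c\<close>. The base point
  \<open>p\<close> is absorbed into that shift.\<close>

lemma tendsto_contour_integral_gaussian:
  fixes \<alpha> :: real and \<beta> p e :: complex
  assumes "\<alpha> > 0" and e: "e\<^sup>2 = \<i>"
  shows "((\<lambda>R. contour_integral (linepath (p - of_real R * e) (p + of_real R * e))
              (\<lambda>z. exp (\<i> * of_real \<alpha> * z\<^sup>2 + \<beta> * z)))
           \<longlongrightarrow> e * of_real (sqrt (pi / \<alpha>)) * exp (\<i> * \<beta>\<^sup>2 / (4 * of_real \<alpha>))) at_top"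
proof -
  define f where "f = (\<lambda>z. exp (\<i> * of_real \<alpha> * z\<^sup>2 + \<beta> * z))"
  define C where "C = exp (\<i> * \<beta>\<^sup>2 / (4 * of_real \<alpha>))"
  \<comment> \<open>The square is centred at \<i> \<beta> / (2 \<alpha>), and \<open>c\<close> is
    the solution of p + t e - \<i> \<beta> / (2 \<alpha>) = e (t + c).\<close>
  define c where "c = (p - \<i> * \<beta> / (2 * of_real \<alpha>)) / e"
  define G where "G = (\<lambda>t::real. exp (- of_real \<alpha> * (of_real t + c)\<^sup>2))"
  have [simp]: "e \<noteq> 0" using e by auto
  have f_eq: "f (p + of_real t * e) = C * G t" for t
  proof -
    have "\<i> * of_real \<alpha> * (p + of_real t * e)\<^sup>2 + \<beta> * (p + of_real t * e)
        = \<i> * of_real \<alpha> * ((p + of_real t * e) - \<i> * \<beta> / (2 * of_real \<alpha>))\<^sup>2 + \<i> * \<beta>\<^sup>2 / (4 * of_real \<alpha>)"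
      using assms by (simp add: power2_eq_square field_simps)
    also have "(p + of_real t * e) - \<i> * \<beta> / (2 * of_real \<alpha>) = e * (of_real t + c)"
      by (simp add: c_def field_simps)
    also have "\<i> * of_real \<alpha> * (e * (of_real t + c))\<^sup>2 = - of_real \<alpha> * (of_real t + c)\<^sup>2"
      unfolding power_mult_distrib e by (simp add: complex_eq_iff)
    finally show ?thesis
      unfolding f_def C_def G_def exp_add[symmetric] by (simp only: add.commute)
  qed
  have "((\<lambda>R. e * (C * integral {-R..R} G)) \<longlongrightarrow> e * (C * of_real (sqrt (pi / \<alpha>)))) at_top"
    unfolding G_def using assms
    by (intro tendsto_intros tendsto_integral_symmetric_interval has_bochner_integral_gaussian_complex)
  moreover have "\<forall>\<^sub>F R in at_top. e * (C * integral {-R..R} G)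
      = contour_integral (linepath (p - of_real R * e) (p + of_real R * e)) f"
    using eventually_gt_at_top[of 0]
  proof eventually_elim
    case (elim R)
    have "G integrable_on {-R..R}"
      unfolding G_def by (intro integrable_continuous_real continuous_intros)
    then have "((\<lambda>t. f (p + of_real t * e)) has_integral (C * integral {-R..R} G)) {-R..R}"
      unfolding f_eq by (intro has_integral_mult_right integrable_integral)
    then show ?case
      using elim contour_integral_unique has_contour_integral_linepath_centred by metis
  qed
  ultimately show ?thesis
    unfolding f_def[symmetric] C_def[symmetric] by (auto simp: mult_ac elim: Lim_transform_eventually)
qed

section \<open>Winding number of a quadrilateral\<close>

text \<open>The hypothesis places z strictly to the left of the directed line from a to b. On the
  segment, b - z would be a real multiple of b - a, making the product real.\<close>

lemma notin_closed_segment_if_left: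
  assumes "0 < Im ((b - a) * cnj (b - z))"
  shows "z \<notin> closed_segment a b"
proof
  assume "z \<in> closed_segment a b"
  then obtain u where "z = (1 - u) *\<^sub>R a + u *\<^sub>R b"
    by (auto simp: closed_segment_def)
  then have "b - z = (1 - u) *\<^sub>R (b - a)"
    by (simp add: algebra_simps)
  with assms show False
    by (simp add: algebra_simps)
qed

text \<open>Each edge contributes a real part strictly between 0 and 1/2, so the total lies strictly
  between 0 and 2. For a closed path it is an integer, hence 1.\<close>

lemma winding_number_quadrilateral:
  assumes "0 < Im ((b - a) * cnj (b - z))" "0 < Im ((c - b) * cnj (c - z))"
    and "0 < Im ((d - c) * cnj (d - z))" "0 < Im ((a - d) * cnj (a - z))"
  shows "winding_number (linepath a b +++ linepath b c +++ linepath c d +++ linepath d a) z = 1"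
proof -
  note z = assms[THEN notin_closed_segment_if_left]
  have sum: "winding_number (linepath a b +++ linepath b c +++ linepath c d +++ linepath d a) z =
      winding_number (linepath a b) z + winding_number (linepath b c) z +
      winding_number (linepath c d) z + winding_number (linepath d a) z"
    using z by (simp add: winding_number_join path_image_join)
  show ?thesis
  proof (rule winding_number_eq_1)
    show "0 < Re (winding_number (linepath a b +++ linepath b c +++ linepath c d +++ linepath d a) z)"
      unfolding sum using assms[THEN winding_number_linepath_pos_lt] by simp
    show "Re (winding_number (linepath a b +++ linepath b c +++ linepath c d +++ linepath d a) z) < 2"
      unfolding sum using z[THEN winding_number_lt_half_linepath] by simp
  qed (use z in \<open>simp_all add: path_image_join\<close>)
qed

section \<open>The kernel with poles at the integers and its residue at 0\<close>

lemma exp_two_pi_i_eq_1_iff: "exp (2 * of_real pi * \<i> * z) = 1 \<longleftrightarrow> z \<in> \<int>"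
proof
  assume "exp (2 * of_real pi * \<i> * z) = 1"
  then obtain n :: int where "Re (2 * of_real pi * \<i> * z) = 0"
      "Im (2 * of_real pi * \<i> * z) = of_int (2 * n) * pi"
    using exp_eq_1 by auto
  then have "z = of_int n"
    by (simp add: complex_eq_iff)
  then show "z \<in> \<int>" by simp
next
  assume "z \<in> \<int>"
  then obtain n :: int where "z = of_int n"
    by (elim Ints_cases)
  then show "exp (2 * of_real pi * \<i> * z) = 1"
    by (auto simp: exp_eq_1 intro!: exI[of _ n])
qed

text \<open>The denominator vanishes at 0 with derivative 2 pi \<i>, so z times the quotient tends
  to h(0) / (2 pi \<i>), and a limit of this kind is the residue.\<close>

lemma residue_over_exp_minus_1:
  assumes "open S" "0 \<in> S" "S \<inter> \<int> \<subseteq> {0}" "h holomorphic_on S"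
  shows "residue (\<lambda>z. h z / (exp (2 * of_real pi * \<i> * z) - 1)) 0 = h 0 / (2 * of_real pi * \<i>)"
proof -
  let ?E = "\<lambda>z. exp (2 * of_real pi * \<i> * z) - 1"
  have nz: "?E z \<noteq> 0" if "z \<in> S - {0}" for z
    using that assms by (auto simp: exp_two_pi_i_eq_1_iff)
  have "(?E has_field_derivative 2 * of_real pi * \<i>) (at 0)"
    by (auto intro!: derivative_eq_intros)
  then have "((\<lambda>z. ?E z / z) \<longlongrightarrow> 2 * of_real pi * \<i>) (at 0)"
    by (simp add: has_field_derivative_iff)
  moreover have "(h \<longlongrightarrow> h 0) (at 0)"
    using assms by (metis continuous_on_eq_continuous_at holomorphic_on_imp_continuous_on isContD)
  ultimately have "((\<lambda>z. h z / (?E z / z)) \<longlongrightarrow> h 0 / (2 * of_real pi * \<i>)) (at 0)"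
    by (intro tendsto_divide) auto
  then have "((\<lambda>z. h z / ?E z * (z - 0)) \<longlongrightarrow> h 0 / (2 * of_real pi * \<i>)) (at 0)"
    by simp
  moreover have "(\<lambda>z. h z / ?E z) holomorphic_on S - {0}"
    using nz by (intro holomorphic_intros holomorphic_on_subset[OF assms(4)]) auto
  ultimately show ?thesis
    using assms by (intro residue_simple'[of S]) auto
qed

section \<open>Residue theorem on the parallelogram\<close>

lemma exp_pi_i_quarter: "exp (of_real pi * \<i> / 4) = of_real (sqrt 2 / 2) * (1 + \<i>)"
  by (simp add: complex_eq_iff Re_exp Im_exp cos_45 sin_45)

text \<open>The residue at 0 yields h(0). The long sides are translates of each other by 1, a period
  of the denominator, so together they give the integral of \<open>q\<close> along the left one. The
  integrability claims serve the later estimates of the short sides.\<close>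

lemma contour_integral_parallelogram_over_exp_minus_1:
  fixes R :: real and h q e
  defines "e \<equiv> exp (of_real pi * \<i> / 4)"
  defines "g \<equiv> (\<lambda>z. h z / (exp (2 * of_real pi * \<i> * z) - 1))"
  assumes h: "h holomorphic_on UNIV" and "R > 0"
    and q: "\<And>z. h (z + 1) - h z = q z * (exp (2 * of_real pi * \<i> * z) - 1)"
  shows "contour_integral (linepath (- 1/2 - of_real R * e) (- 1/2 + of_real R * e)) q
       + (contour_integral (linepath (1/2 + of_real R * e) (- 1/2 + of_real R * e)) g
       + contour_integral (linepath (- 1/2 - of_real R * e) (1/2 - of_real R * e)) g) = h 0"
    and "g contour_integrable_on linepath (1/2 + of_real R * e) (- 1/2 + of_real R * e)"
    and "g contour_integrable_on linepath (- 1/2 - of_real R * e) (1/2 - of_real R * e)"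
proof -
  define p where "p = of_real R * e"
  have p: "Re p = Im p" "Im p > 0"
    using \<open>R > 0\<close> by (auto simp: p_def e_def exp_pi_i_quarter)
  \<comment> \<open>An open strip in the direction of \<open>e\<close> that contains the parallelogram but no integer other than 0.\<close>
  define S where "S = {z. \<bar>Re z - Im z\<bar> < 1}"
  have S_eq: "S = {z. inner (1 - \<i>) z < 1} \<inter> {z. inner (- 1 + \<i>) z < 1}"
    by (auto simp: S_def inner_complex_def)
  have S: "open S" "convex S"
    unfolding S_eq by (auto intro!: open_Int open_halfspace_lt convex_Int convex_halfspace_lt)
  have S_Ints: "S \<inter> \<int> \<subseteq> {0}"
    by (auto simp: S_def elim!: Ints_cases)
  have holo: "g holomorphic_on S - {0}"
    unfolding g_def using S_Ints
    by (intro holomorphic_intros holomorphic_on_subset[OF h]) (auto simp: exp_two_pi_i_eq_1_iff)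
  define \<gamma> where "\<gamma> = linepath (1/2 - p) (1/2 + p) +++ linepath (1/2 + p) (- 1/2 + p) +++
      linepath (- 1/2 + p) (- 1/2 - p) +++ linepath (- 1/2 - p) (1/2 - p)"
  \<comment> \<open>The origin is to the left of every edge: each of the four imaginary parts equals
    \<open>Im p\<close>.\<close>
  have ccw: "0 < Im ((1/2 + p - (1/2 - p)) * cnj (1/2 + p - 0))"
      "0 < Im ((- 1/2 + p - (1/2 + p)) * cnj (- 1/2 + p - 0))"
      "0 < Im ((- 1/2 - p - (- 1/2 + p)) * cnj (- 1/2 - p - 0))"
      "0 < Im ((1/2 - p - (- 1/2 - p)) * cnj (1/2 - p - 0))"
    using p by (auto simp: algebra_simps)
  \<comment> \<open>Since \<open>Re p = Im p\<close>, every corner has Re - Im equal to 1/2 or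
    -1/2.\<close>
  have corners: "1/2 - p \<in> S" "1/2 + p \<in> S" "- 1/2 + p \<in> S" "- 1/2 - p \<in> S"
    using p by (auto simp: S_def)
  note off = ccw[THEN notin_closed_segment_if_left]
  have on: "closed_segment u v \<subseteq> S - {0}" if "u \<in> S" "v \<in> S" "0 \<notin> closed_segment u v" for u v
    using closed_segment_subset[OF that(1,2) S(2)] that(3) by auto
  have int: "g contour_integrable_on linepath u v"
    if "u \<in> S" "v \<in> S" "0 \<notin> closed_segment u v" for u v
    using on[OF that] S holo by (intro contour_integrable_holomorphic_simple[of _ "S - {0}"]) auto
  show int2: "g contour_integrable_on linepath (1/2 + of_real R * e) (- 1/2 + of_real R * e)"
    and int4: "g contour_integrable_on linepath (- 1/2 - of_real R * e) (1/2 - of_real R * e)"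
    using int off corners unfolding p_def by blast+
  have \<gamma>_on: "path_image \<gamma> \<subseteq> S - {0}"
    unfolding \<gamma>_def using on off corners by (simp add: path_image_join)
  have \<gamma>: "valid_path \<gamma>" "pathfinish \<gamma> = pathstart \<gamma>"
    by (auto simp: \<gamma>_def)
  have "contour_integral \<gamma> g = 2 * pi * \<i> * (\<Sum>z\<in>{0}. winding_number \<gamma> z * residue g z)"
  proof (rule Residue_theorem[of S])
    show "\<forall>z. z \<notin> S \<longrightarrow> winding_number \<gamma> z = 0"
      using \<gamma> \<gamma>_on S by (auto intro!: winding_number_zero_outside[of \<gamma> S] valid_path_imp_path)
  qed (use S holo \<gamma> \<gamma>_on in \<open>auto intro: convex_connected\<close>)
  also have "(\<Sum>z\<in>{0}. winding_number \<gamma> z * residue g z) = winding_number \<gamma> 0 * residue g 0"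
    by simp
  also have "winding_number \<gamma> 0 = 1"
    unfolding \<gamma>_def using ccw by (rule winding_number_quadrilateral)
  also have "residue g 0 = h 0 / (2 * of_real pi * \<i>)"
    unfolding g_def using S S_Ints
    by (intro residue_over_exp_minus_1[of S] holomorphic_on_subset[OF h]) (auto simp: S_def)
  finally have total: "contour_integral \<gamma> g = h 0"
    by simp
  \<comment> \<open>On the left long side the denominator is nonzero and takes the same value at z
    and z + 1, so the hypothesis on \<open>q\<close> can be divided by it.\<close>
  have q_eq: "g (z + 1) - g z = q z" if "z \<in> closed_segment (- 1/2 - p) (- 1/2 + p)" for z
  proof -
    have "z \<in> S - {0}"
      using on[OF _ _ off(3)] corners that by (auto simp: closed_segment_commute)
    then have "exp (2 * of_real pi * \<i> * z) \<noteq> 1"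
      using S_Ints by (auto simp: exp_two_pi_i_eq_1_iff)
    moreover have "exp (2 * of_real pi * \<i> * (z + 1)) = exp (2 * of_real pi * \<i> * z)"
      by (simp add: distrib_left exp_add)
    ultimately show ?thesis
      unfolding g_def using q[of z] by (simp add: diff_divide_distrib[symmetric])
  qed
  define I1 where "I1 = contour_integral (linepath (1/2 - p) (1/2 + p)) g"
  define I3 where "I3 = contour_integral (linepath (- 1/2 - p) (- 1/2 + p)) g"
  have I1: "(g has_contour_integral I1) (linepath (1/2 - p) (1/2 + p))"
    unfolding I1_def using int[OF _ _ off(1)] corners by (intro has_contour_integral_integral) auto
  have I3: "(g has_contour_integral I3) (linepath (- 1/2 - p) (- 1/2 + p))"
    unfolding I3_def using int[of "- 1/2 - p" "- 1/2 + p"] off(3) corners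
    by (intro has_contour_integral_integral) (auto simp: closed_segment_commute)
  have "((\<lambda>z. g (z + 1)) has_contour_integral I1) (linepath (- 1/2 - p) (- 1/2 + p))"
    using I1 has_contour_integral_linepath_translate[of g I1 "- 1/2 - p" 1 "- 1/2 + p"] by simp
  then have "((\<lambda>z. g (z + 1) - g z) has_contour_integral I1 - I3) (linepath (- 1/2 - p) (- 1/2 + p))"
    using I3 by (rule has_contour_integral_diff)
  then have "(q has_contour_integral I1 - I3) (linepath (- 1/2 - p) (- 1/2 + p))"
    by (rule has_contour_integral_eq) (use q_eq in auto)
  then have I_q: "contour_integral (linepath (- 1/2 - p) (- 1/2 + p)) q = I1 - I3"
    by (rule contour_integral_unique)
  \<comment> \<open>The contour runs down the left side, whereas \<open>I3\<close> is taken upwards;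
    hence the sign.\<close>
  have "(g has_contour_integral - I3) (linepath (- 1/2 + p) (- 1/2 - p))"
    using has_contour_integral_reversepath[OF _ I3] by simp
  then have "contour_integral \<gamma> g = I1 + (contour_integral (linepath (1/2 + p) (- 1/2 + p)) g
      + (- I3 + contour_integral (linepath (- 1/2 - p) (1/2 - p)) g))"
    unfolding \<gamma>_def p_def using I1[unfolded p_def] int2 int4
    by (intro contour_integral_unique has_contour_integral_join valid_path_join has_contour_integral_integral) auto
  then show "contour_integral (linepath (- 1/2 - of_real R * e) (- 1/2 + of_real R * e)) q
       + (contour_integral (linepath (1/2 + of_real R * e) (- 1/2 + of_real R * e)) g
       + contour_integral (linepath (- 1/2 - of_real R * e) (1/2 - of_real R * e)) g) = h 0"
    using total I_q by (simp add: p_def)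
qed

section \<open>Estimates on the short sides\<close>

text \<open>The square of \<sigma> R e is \<i> R^2, which contributes -\<alpha> R^2 to the real part
  of the exponent; the cross term is only linear in R and is bounded crudely through sqrt 2 \<le> 2
  and |x + n| \<le> a + 1. The sign \<sigma> selects the upper or the lower short side.\<close>

lemma norm_gaussian_shift_le:
  fixes x R \<alpha> :: real and n a :: nat
  assumes "\<alpha> > 0" "R \<ge> 0" "\<bar>x\<bar> \<le> 1/2" "n \<le> a" "\<sigma> = 1 \<or> \<sigma> = - 1"
  shows "norm (exp (\<i> * of_real \<alpha> * (of_real x + of_real (\<sigma> * R) * exp (of_real pi * \<i> / 4) + of_nat n)\<^sup>2))
           \<le> exp (\<alpha> * (2 * (a + 1) * R - R\<^sup>2))"
proof -
  have "Re (\<i> * of_real \<alpha> * (of_real x + of_real (\<sigma> * R) * exp (of_real pi * \<i> / 4) + of_nat n)\<^sup>2)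
      = \<alpha> * (- \<sigma> * (sqrt 2 * (x + n)) * R - R\<^sup>2)"
    using assms(5) unfolding exp_pi_i_quarter by (auto simp: power2_eq_square algebra_simps)
  also have "\<dots> \<le> \<alpha> * (2 * (a + 1) * R - R\<^sup>2)"
  proof -
    have "\<bar>- \<sigma> * (sqrt 2 * (x + n))\<bar> = sqrt 2 * \<bar>x + n\<bar>"
      using assms(5) by (auto simp: abs_mult)
    also have "\<dots> \<le> 2 * (a + 1)"
    proof -
      have "sqrt 2 \<le> 2" "\<bar>x + n\<bar> \<le> a + 1"
        using assms real_sqrt_le_mono[of 2 4] by auto
      then have "sqrt 2 * \<bar>x + n\<bar> \<le> 2 * (real a + 1)"
        by (intro mult_mono) auto
      then show ?thesis by simp
    qed
    finally have "- \<sigma> * (sqrt 2 * (x + n)) \<le> 2 * (a + 1)"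
      by linarith
    then show ?thesis
      using assms by (intro mult_left_mono diff_right_mono mult_right_mono) auto
  qed
  finally show ?thesis
    by (simp add: norm_exp_eq_Re)
qed

text \<open>The exponential has modulus exp (- \<sigma> y) with y = sqrt 2 pi R \<ge> 1, so the
  modulus is at most 1/2 or at least 2, and the distance to 1 is at least 1/2.\<close>

lemma norm_exp_minus_1_ge_half:
  fixes x R :: real
  assumes "R \<ge> 1" "\<sigma> = 1 \<or> \<sigma> = - 1"
  shows "norm (exp (2 * of_real pi * \<i> * (of_real x + of_real (\<sigma> * R) * exp (of_real pi * \<i> / 4))) - 1) \<ge> 1 / 2"
proof -
  define y where "y = sqrt 2 * pi * R"
  define w where "w = exp (2 * of_real pi * \<i> * (of_real x + of_real (\<sigma> * R) * exp (of_real pi * \<i> / 4)))"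
  have "1 * 1 * 1 \<le> y"
    unfolding y_def using assms pi_ge_two by (intro mult_mono) auto
  then have y: "exp y \<ge> 2"
    using exp_ge_add_one_self[of y] by linarith
  have "norm w = exp (- \<sigma> * y)"
    unfolding w_def exp_pi_i_quarter by (simp add: y_def norm_exp_eq_Re)
  then have "norm w \<le> 1 / 2 \<or> norm w \<ge> 2"
    using assms(2) y le_imp_inverse_le[OF y] by (auto simp: exp_minus)
  moreover have "norm w - norm (1::complex) \<le> norm (w - 1)" "norm (1::complex) - norm w \<le> norm (w - 1)"
    by (metis norm_triangle_ineq2, metis norm_minus_commute norm_triangle_ineq2)
  ultimately show ?thesis
    unfolding w_def[symmetric] by auto
qed

section \<open>The two Gauss sums\<close>

theorem mainTheorem1:
  fixes a b :: nat
  assumes "a > 0" and "b > 0"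
  shows "1 / complex_of_real (sqrt (real a)) *
           (\<Sum>n = 0..<a. exp (2 * complex_of_real pi * \<i> * (of_nat n)\<^sup>2 * of_nat b / of_nat a))
       = 1 / complex_of_real (sqrt (2 * real b)) * exp (complex_of_real pi * \<i> / 4) *
           (\<Sum>n = 0..<2 * b. exp (- (complex_of_real pi * \<i> * (of_nat n)\<^sup>2 * of_nat a / (2 * of_nat b))))"
proof -
  define \<alpha> where "\<alpha> = 2 * pi * b / a"
  have "\<alpha> > 0" using assms by (simp add: \<alpha>_def)
  define e where "e = exp (complex_of_real pi * \<i> / 4)"
  have e2: "e\<^sup>2 = \<i>"
    by (simp add: e_def exp_pi_i_quarter complex_eq_iff power2_eq_square)
  define w where "w = (\<lambda>z::complex. exp (2 * of_real pi * \<i> * z))"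
  define h where "h = (\<lambda>z. \<Sum>n<a. exp (\<i> * of_real \<alpha> * (z + of_nat n)\<^sup>2))"
  define q where "q = (\<lambda>z. \<Sum>k<2 * b. exp (\<i> * of_real \<alpha> * z\<^sup>2 + (2 * of_real pi * \<i> * of_nat k) * z))"
  define g where "g = (\<lambda>z. h z / (w z - 1))"
  have hol: "h holomorphic_on UNIV"
    unfolding h_def by (intro holomorphic_intros)
  have diff: "h (z + 1) - h z = q z * (w z - 1)" for z
  proof -
    have "h (z + 1) - h z = (\<Sum>n<a. exp (\<i> * of_real \<alpha> * (z + of_nat (Suc n))\<^sup>2) - exp (\<i> * of_real \<alpha> * (z + of_nat n)\<^sup>2))"
      by (simp add: h_def sum_subtractf add_ac)
    also have "\<dots> = exp (\<i> * of_real \<alpha> * (z + of_nat a)\<^sup>2) - exp (\<i> * of_real \<alpha> * z\<^sup>2)"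
      by (subst sum_lessThan_telescope) simp
    \<comment> \<open>Here 2 \<alpha> a = 4 pi b and \<alpha> a^2 = 2 pi a b. The shift by a thus
      multiplies the Gaussian by w(z)^(2b), the last summand being a multiple of 2 pi \<i>; the
      geometric sum then has 2b terms.\<close>
    also have "\<i> * of_real \<alpha> * (z + of_nat a)\<^sup>2
        = \<i> * of_real \<alpha> * z\<^sup>2 + (of_nat (2 * b) * (2 * of_real pi * \<i> * z) + 2 * of_real pi * \<i> * of_nat (a * b))"
      using assms by (simp add: \<alpha>_def power2_eq_square field_simps)
    also have "exp \<dots> = exp (\<i> * of_real \<alpha> * z\<^sup>2) * w z ^ (2 * b)"
      using exp_two_pi_i_eq_1_iff[of "of_nat (a * b)"]
      by (simp only: exp_add w_def exp_of_nat_mult) simp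
    also have "\<dots> - exp (\<i> * of_real \<alpha> * z\<^sup>2) = exp (\<i> * of_real \<alpha> * z\<^sup>2) * (w z ^ (2 * b) - 1)"
      by (simp add: algebra_simps)
    also have "\<dots> = (\<Sum>k<2 * b. exp (\<i> * of_real \<alpha> * z\<^sup>2) * w z ^ k) * (w z - 1)"
      by (simp add: power_diff_1_eq flip: sum_distrib_left)
    also have "(\<Sum>k<2 * b. exp (\<i> * of_real \<alpha> * z\<^sup>2) * w z ^ k) = q z"
      by (simp add: q_def w_def exp_add mult_ac flip: exp_of_nat_mult)
    finally show ?thesis .
  qed
  define side where "side = (\<lambda>R. contour_integral (linepath (1/2 + of_real R * e) (- 1/2 + of_real R * e)) g
       + contour_integral (linepath (- 1/2 - of_real R * e) (1/2 - of_real R * e)) g)"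
  have main: "contour_integral (linepath (- 1/2 - of_real R * e) (- 1/2 + of_real R * e)) q + side R = h 0"
    if "R > 0" for R
    using contour_integral_parallelogram_over_exp_minus_1(1)[OF hol that diff[unfolded w_def]]
    by (simp add: side_def g_def w_def e_def)
  \<comment> \<open>The Gaussian limit is applied to each term with p = -1/2 and \<beta> = 2 pi \<i>
    k.\<close>
  have lim_q: "((\<lambda>R. contour_integral (linepath (- 1/2 - of_real R * e) (- 1/2 + of_real R * e)) q) \<longlongrightarrow>
      (\<Sum>k<2 * b. e * of_real (sqrt (pi / \<alpha>)) * exp (\<i> * (2 * of_real pi * \<i> * of_nat k)\<^sup>2 / (4 * of_real \<alpha>)))) at_top"
  proof -
    have "contour_integral (linepath (- 1/2 - of_real R * e) (- 1/2 + of_real R * e)) q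
        = (\<Sum>k<2 * b. contour_integral (linepath (- 1/2 - of_real R * e) (- 1/2 + of_real R * e))
            (\<lambda>z. exp (\<i> * of_real \<alpha> * z\<^sup>2 + (2 * of_real pi * \<i> * of_nat k) * z)))" for R
      unfolding q_def
      by (intro contour_integral_sum contour_integrable_continuous_linepath continuous_intros) auto
    then show ?thesis
      using \<open>\<alpha> > 0\<close> e2 by (simp only:) (intro tendsto_sum tendsto_contour_integral_gaussian)
  qed
  have lim_side: "(side \<longlongrightarrow> 0) at_top"
  proof (rule Lim_null_comparison)
    show "((\<lambda>R::real. 4 * a * exp (\<alpha> * (2 * (a + 1) * R - R\<^sup>2))) \<longlongrightarrow> 0) at_top"
      using \<open>\<alpha> > 0\<close> by real_asymp
    show "\<forall>\<^sub>F R::real in at_top. norm (side R) \<le> 4 * a * exp (\<alpha> * (2 * (a + 1) * R - R\<^sup>2))"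
      using eventually_ge_at_top[of 1]
    proof eventually_elim
      case (elim R)
      \<comment> \<open>There are a summands in \<open>h\<close>, and the denominator costs a factor
        2. Two sides of length 1 then give the constant 4 a.\<close>
      define B where "B = 2 * a * exp (\<alpha> * (2 * (a + 1) * R - R\<^sup>2))"
      have g_le: "norm (g (of_real x + of_real (\<sigma> * R) * e)) \<le> B" if "\<bar>x\<bar> \<le> 1/2" "\<sigma> = 1 \<or> \<sigma> = -1" for x \<sigma>
      proof -
        define z where "z = of_real x + of_real (\<sigma> * R) * e"
        have "norm (h z) \<le> a * exp (\<alpha> * (2 * (a + 1) * R - R\<^sup>2))"
          unfolding h_def z_def e_def
          using sum_norm_bound[of "{..<a}", OF norm_gaussian_shift_le[of \<alpha> R x _ a \<sigma>]] that elim \<open>\<alpha> > 0\<close>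
          by auto
        moreover have "norm (w z - 1) \<ge> 1 / 2"
          unfolding w_def z_def e_def using norm_exp_minus_1_ge_half elim that by auto
        ultimately have "norm (h z) / norm (w z - 1) \<le> a * exp (\<alpha> * (2 * (a + 1) * R - R\<^sup>2)) / (1 / 2)"
          by (intro frac_le) auto
        then show ?thesis
          by (simp add: g_def B_def z_def norm_divide)
      qed
      have "B \<ge> 0" by (simp add: B_def)
      \<comment> \<open>Both short sides are horizontal: c = R e gives the upper one and c = - R e
        the lower one traversed backwards.\<close>
      have seg: "\<exists>x. \<bar>x\<bar> \<le> 1/2 \<and> z = of_real x + c" if "z \<in> closed_segment (1/2 + c) (- 1/2 + c)" for z c :: complex
      proof -
        from that obtain u where u: "0 \<le> u" "u \<le> 1" "z = (1 - u) *\<^sub>R (1/2 + c) + u *\<^sub>R (- 1/2 + c)"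
          by (auto simp: closed_segment_def)
        then have "z = of_real (1/2 - u) + c"
          by (simp add: complex_eq_iff algebra_simps)
        moreover have "\<bar>1/2 - u\<bar> \<le> 1/2"
          using u(1,2) by linarith
        ultimately show ?thesis by blast
      qed
      have "norm (contour_integral (linepath (1/2 + of_real R * e) (- 1/2 + of_real R * e)) g)
          \<le> B * norm ((- 1/2 + of_real R * e) - (1/2 + of_real R * e))"
      proof (rule contour_integral_bound_linepath)
        show "g contour_integrable_on linepath (1/2 + of_real R * e) (- 1/2 + of_real R * e)"
          using contour_integral_parallelogram_over_exp_minus_1(2)[OF hol _ diff[unfolded w_def], of R] elim
          by (simp add: g_def w_def e_def)
        show "norm (g z) \<le> B" if "z \<in> closed_segment (1/2 + of_real R * e) (- 1/2 + of_real R * e)" for z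
          using seg[OF that] g_le[of _ 1] by auto
      qed fact
      moreover have "norm (contour_integral (linepath (- 1/2 - of_real R * e) (1/2 - of_real R * e)) g)
          \<le> B * norm ((1/2 - of_real R * e) - (- 1/2 - of_real R * e))"
      proof (rule contour_integral_bound_linepath)
        show "g contour_integrable_on linepath (- 1/2 - of_real R * e) (1/2 - of_real R * e)"
          using contour_integral_parallelogram_over_exp_minus_1(3)[OF hol _ diff[unfolded w_def], of R] elim
          by (simp add: g_def w_def e_def)
        show "norm (g z) \<le> B" if "z \<in> closed_segment (- 1/2 - of_real R * e) (1/2 - of_real R * e)" for z
          using seg[of z "- of_real R * e"] g_le[of _ "- 1"] that by (auto simp: closed_segment_commute)
      qed fact
      ultimately show ?case
        unfolding side_def
        by (intro norm_triangle_le) (simp add: B_def)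
    qed
  qed
  have "\<forall>\<^sub>F R in at_top. contour_integral (linepath (- 1/2 - of_real R * e) (- 1/2 + of_real R * e)) q
      + side R = h 0"
    using eventually_gt_at_top[of 0] by eventually_elim (rule main)
  \<comment> \<open>The sum of the two contributions is h(0) for every R > 0, so h(0) equals the
    limit.\<close>
  then have "((\<lambda>R::real. h 0) \<longlongrightarrow> (\<Sum>k<2 * b. e * of_real (sqrt (pi / \<alpha>)) * exp (\<i> * (2 * of_real pi * \<i> * of_nat k)\<^sup>2 / (4 * of_real \<alpha>))) + 0) at_top"
    by (rule Lim_transform_eventually[OF tendsto_add[OF lim_q lim_side]])
  then have "h 0 = (\<Sum>k<2 * b. e * of_real (sqrt (pi / \<alpha>)) * exp (\<i> * (2 * of_real pi * \<i> * of_nat k)\<^sup>2 / (4 * of_real \<alpha>)))"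
    unfolding add_0_right by (subst (asm) tendsto_const_iff) auto
  \<comment> \<open>For \<beta> = 2 pi \<i> k the exponent \<i> \<beta>^2 / (4 \<alpha>) is -\<i>
    pi^2 k^2 / \<alpha>, and pi / \<alpha> = a / (2 b).\<close>
  also have "\<dots> = e * of_real (sqrt (pi / \<alpha>)) * (\<Sum>k<2 * b. exp (- (of_real pi * \<i> * (of_nat k)\<^sup>2 * of_nat a / (2 * of_nat b))))"
    using assms by (simp add: sum_distrib_left \<alpha>_def power_mult_distrib power2_eq_square mult_ac)
  also have "sqrt (pi / \<alpha>) = sqrt a / sqrt (2 * b)"
    using assms by (simp add: \<alpha>_def real_sqrt_divide)
  finally have "h 0 = e * of_real (sqrt a / sqrt (2 * b)) * (\<Sum>k<2 * b. exp (- (of_real pi * \<i> * (of_nat k)\<^sup>2 * of_nat a / (2 * of_nat b))))" .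
  moreover have "h 0 = (\<Sum>n = 0..<a. exp (2 * complex_of_real pi * \<i> * (of_nat n)\<^sup>2 * of_nat b / of_nat a))"
    unfolding h_def \<alpha>_def by (intro sum.cong) (auto simp: mult_ac)
  ultimately show ?thesis
    using assms by (simp add: e_def atLeast0LessThan)
qed

end
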